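(* Let $n \ge 1$ be an integer, let $p_1, p_2, \dots, p_n$ be the first $n$ primes, and let $x$ be a positive real number. Let $T_n(x)$ be the number of positive integers $a \le x$ such that neither $a-1$ nor $a+1$ is divisible by any of $p_1,\dots,p_n$. Then $$T_n(x) = [x] - \sum_{i} D_{\{p_i\}}(x) + \sum_{i<j} D_{\{p_i,p_j\}}(x) - \sum_{i<j<k} D_{\{p_i,p_j,p_k\}}(x) + \cdots + (-1)^n D_{\{p_1,p_2,\dots,p_n\}}(x),$$ where the sums are taken over all singles, then all doubles, triples, etc. of the first $n$ primes.
   Context: $[y]$ denotes the integer part (floor) of the real number $y$. For a finite nonempty set $S$ of primes, put $P_S=\prod_{p\in S}p$. The set of discarded $S$-prime centers $D_S$ is the set of integers $z$ with $0\le z\le P_S$ such that every $p\in S$ divides $z-1$ or $z+1$. For a positive real number $x$, $$D_S(x)=\sum_{z\in D_S}\left[\frac{x+z}{P_S}\right].$$ The divisibility convention is that $0$ is divisible by every prime. *)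

theory Defs
  imports Complex_Main "HOL-Library.Infinite_Set" "HOL-Computational_Algebra.Primes"
begin

text \<open>The primes are indexed from one, so that \<open>nth_prime 1 = 2\<close>;
  \<open>enumerate\<close> itself counts from zero. The value at \<open>0\<close> is never used.\<close>

definition nth_prime :: "nat \<Rightarrow> nat" where
  "nth_prime i = enumerate {p. prime p} (i - 1)"

definition first_primes :: "nat \<Rightarrow> nat set" where
  "first_primes n = nth_prime ` {1..n}"

text \<open>Here \<open>\<Prod>S\<close> is $P_S$. The centers are integers, so \<open>z - 1\<close> is not truncated at \<open>z = 0\<close>.\<close>

definition discarded_centers :: "nat set \<Rightarrow> int set" where
  "discarded_centers S =
     {z. 0 \<le> z \<and> z \<le> int (\<Prod>S) \<and> (\<forall>p\<in>S. int p dvd z - 1 \<or> int p dvd z + 1)}"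

definition discarded_count :: "nat set \<Rightarrow> real \<Rightarrow> int" where
  "discarded_count S x =
     (\<Sum>z\<in>discarded_centers S. \<lfloor>(x + real_of_int z) / real (\<Prod>S)\<rfloor>)"

definition surviving_centers :: "nat \<Rightarrow> real \<Rightarrow> int set" where
  "surviving_centers n x =
     {a. 0 < a \<and> real_of_int a \<le> x \<and>
         (\<forall>p\<in>first_primes n. \<not> int p dvd a - 1 \<and> \<not> int p dvd a + 1)}"

end

theory Submission
  imports Defs
begin

text \<open>
  The theorem is inclusion--exclusion over the primes \<open>p\<close> in \<open>first_primes n\<close>, applied to the
  properties ``\<open>p\<close> divides \<open>a - 1\<close> or \<open>a + 1\<close>'' of the integers \<open>1 \<le> a \<le> x\<close>
  (\<open>card_sieve\<close>). It remains to see that \<open>discarded_count S x\<close> counts the \<open>a\<close> that have the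
  property for every \<open>p \<in> S\<close> (\<open>discarded_count_eq_card\<close>). Whether they do depends only on \<open>a\<close>
  modulo \<open>P = \<Prod>S\<close>, so they fall into the residue classes of the discarded centers. The
  floor \<open>\<lfloor>(x + z) / P\<rfloor>\<close> counts the members \<open>P - z, 2P - z, \<dots>\<close> of the class of \<open>- z\<close> up to
  \<open>x\<close>, not those of the class of \<open>z\<close>; this makes no difference to the total because the set of
  centers is symmetric under negation modulo \<open>P\<close>.

  The empty \<open>S\<close> is the exception: its centers are \<open>0\<close> and \<open>1\<close>, which represent the same
  class modulo \<open>P = 1\<close>. Its term in the inclusion--exclusion sum is \<open>\<lfloor>x\<rfloor>\<close>, which the
  formula lists separately.
\<close>

section \<open>Inclusion--exclusion\<close>

text \<open>Expanding \<open>\<Prod>p\<in>F. (1 - [Q p a])\<close> over the subsets of \<open>F\<close> and summing over \<open>a\<close>. The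
  properties are indexed by \<open>F\<close>, so that different indices may define the same subset of \<open>A\<close>
  (as happens for two primes that are large compared with \<open>x\<close>).\<close>

lemma card_sieve:
  assumes "finite A" and "finite F"
  shows "int (card {a\<in>A. \<forall>p\<in>F. \<not> Q p a}) =
    (\<Sum>S\<in>Pow F. (- 1) ^ card S * int (card {a\<in>A. \<forall>p\<in>S. Q p a}))"
proof -
  have prod_indicator: "(\<Prod>p\<in>S. of_bool (R p)) = (of_bool (\<forall>p\<in>S. R p) :: int)"
    if "finite S" for S and R :: "'b \<Rightarrow> bool"
    using that by (induction S rule: finite_induct) auto
  have card_indicator: "int (card {a\<in>A. R a}) = (\<Sum>a\<in>A. of_bool (R a))" for R
    using \<open>finite A\<close> by (simp add: Int_def)
  have "int (card {a\<in>A. \<forall>p\<in>F. \<not> Q p a}) = (\<Sum>a\<in>A. \<Prod>p\<in>F. 1 - of_bool (Q p a))"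
    unfolding card_indicator
    by (intro sum.cong refl) (simp add: prod_indicator \<open>finite F\<close> flip: of_bool_not_iff)
  also have "\<dots> = (\<Sum>a\<in>A. \<Sum>S\<in>Pow F. (- 1) ^ card S * of_bool (\<forall>p\<in>S. Q p a))"
    using \<open>finite F\<close> finite_subset[OF _ \<open>finite F\<close>]
    by (intro sum.cong refl) (simp add: prod_diff_conv_sum prod_indicator)
  also have "\<dots> = (\<Sum>S\<in>Pow F. \<Sum>a\<in>A. (- 1) ^ card S * of_bool (\<forall>p\<in>S. Q p a))"
    by (rule sum.swap)
  also have "\<dots> = (\<Sum>S\<in>Pow F. (- 1) ^ card S * int (card {a\<in>A. \<forall>p\<in>S. Q p a}))"
    unfolding card_indicator by (simp only: sum_distrib_left)
  finally show ?thesis .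
qed

section \<open>Counting discarded centers\<close>

definition discarded_upto :: "nat set \<Rightarrow> real \<Rightarrow> int set" where
  "discarded_upto S x =
     {a\<in>{1..\<lfloor>x\<rfloor>}. \<forall>p\<in>S. int p dvd a - 1 \<or> int p dvd a + 1}"

text \<open>The condition on centers is invariant under \<open>z \<mapsto> m - z\<close> for every common multiple \<open>m\<close>,
  as \<open>p\<close> divides \<open>(m - z) \<plusminus> 1\<close> iff it divides \<open>z \<mp> 1\<close>. This is both the periodicity
  and the symmetry of the set of centers.\<close>

lemma dvd_neighbour_reflect:
  fixes p m z :: int
  assumes "p dvd m"
  shows "(p dvd (m - z) - 1 \<or> p dvd (m - z) + 1) \<longleftrightarrow> (p dvd z - 1 \<or> p dvd z + 1)"
proof -
  have "p dvd (m - z) - 1 \<longleftrightarrow> p dvd z + 1"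
    using dvd_diff_right_iff[OF assms, of "z + 1"] by (simp add: algebra_simps)
  moreover have "p dvd (m - z) + 1 \<longleftrightarrow> p dvd z - 1"
    using dvd_diff_right_iff[OF assms, of "z - 1"] by (simp add: algebra_simps)
  ultimately show ?thesis by blast
qed

text \<open>The end point \<open>\<Prod>S\<close> is no center, since a divisor of \<open>\<Prod>S\<close> that divides a neighbour of it
  is a unit. So the centers represent every residue class at most once.\<close>

lemma discarded_center_less_prod:
  assumes S: "finite S" "S \<noteq> {}" "\<And>p. p \<in> S \<Longrightarrow> p > 1" and z: "z \<in> discarded_centers S"
  shows "z < int (\<Prod>S)"
proof -
  obtain p where p: "p \<in> S" using S by blast
  have dvd: "int p dvd int (\<Prod>S)" using S p by (simp only: int_dvd_int_iff) (rule dvd_prodI)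
  have "z \<noteq> int (\<Prod>S)"
  proof
    assume "z = int (\<Prod>S)"
    then have "int p dvd int (\<Prod>S) - 1 \<or> int p dvd int (\<Prod>S) + 1"
      using z p by (auto simp: discarded_centers_def)
    then have "int p dvd 1"
      using dvd by (metis dvd_add_right_iff dvd_diff_right_iff)
    then show False using S(3)[OF p] by simp
  qed
  then show ?thesis using z by (simp add: discarded_centers_def)
qed

text \<open>Every \<open>a\<close> is \<open>k P - z\<close> for exactly one \<open>k\<close> and one \<open>0 \<le> z < P\<close>; here \<open>a > 0\<close> becomes
  \<open>k \<ge> 1\<close> and \<open>a \<le> x\<close> becomes \<open>k \<le> \<lfloor>(x + z) / P\<rfloor>\<close>.\<close>

lemma discarded_count_eq_card:
  assumes S: "finite S" "S \<noteq> {}" "\<And>p. p \<in> S \<Longrightarrow> p > 1" and "x > 0"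
  shows "discarded_count S x = int (card (discarded_upto S x))"
proof -
  define P where "P = int (\<Prod>S)"
  define K where "K z = {1..\<lfloor>(x + real_of_int z) / real (\<Prod>S)\<rfloor>}" for z
  define D where "D = discarded_centers S"
  have "\<Prod>S > 0" using S(3) by (fastforce intro: prod_pos)
  then have P: "P > 0" by (simp only: P_def of_nat_0_less_iff)
  have dvd: "int p dvd P" if "p \<in> S" for p
    unfolding P_def using S that by (simp only: int_dvd_int_iff) (rule dvd_prodI)
  have less: "z < P" if "z \<in> D" for z
    using discarded_center_less_prod[OF S] that by (simp add: P_def D_def)
  have finD: "finite D"
    by (rule finite_subset[of _ "{0..P}"]) (auto simp: D_def discarded_centers_def P_def)
  have K_iff: "k \<in> K z \<longleftrightarrow> 1 \<le> k \<and> k * P - z \<le> \<lfloor>x\<rfloor>" for k z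
  proof -
    have "k \<le> \<lfloor>(x + real_of_int z) / real (\<Prod>S)\<rfloor> \<longleftrightarrow> real_of_int k * real (\<Prod>S) \<le> x + z"
      using \<open>\<Prod>S > 0\<close> by (simp only: le_floor_iff pos_le_divide_eq of_nat_0_less_iff)
    also have "\<dots> \<longleftrightarrow> real_of_int (k * P - z) \<le> x"
      by (simp add: P_def algebra_simps)
    finally show ?thesis by (simp only: K_def atLeastAtMost_iff le_floor_iff)
  qed
  have "bij_betw (\<lambda>(z, k). k * P - z) (SIGMA z:D. K z) (discarded_upto S x)"
  proof (rule bij_betw_byWitness[where f' = "\<lambda>a. ((- a) mod P, - ((- a) div P))"])
    show "\<forall>u\<in>SIGMA z:D. K z.
      (\<lambda>a. ((- a) mod P, - ((- a) div P))) ((\<lambda>(z, k). k * P - z) u) = u"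
    proof safe
      fix z k assume "z \<in> D"
      then have "0 \<le> z" "z < P" using less by (auto simp: D_def discarded_centers_def)
      moreover have eq: "- (k * P - z) = z + (- k) * P" by simp
      ultimately show "(- (k * P - z)) mod P = z" "- ((- (k * P - z)) div P) = k"
        using P unfolding eq mod_mult_self1 by (simp_all only: div_mult_self1) simp_all
    qed
    show "\<forall>a\<in>discarded_upto S x.
      (\<lambda>(z, k). k * P - z) ((\<lambda>a. ((- a) mod P, - ((- a) div P))) a) = a"
    proof
      show "(\<lambda>(z, k). k * P - z) ((- a) mod P, - ((- a) div P)) = a" for a
        using div_mult_mod_eq[of "- a" P] by (simp only: prod.case mult_minus_left)
    qed
    show "(\<lambda>(z, k). k * P - z) ` (SIGMA z:D. K z) \<subseteq> discarded_upto S x"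
    proof safe
      fix z k assume z: "z \<in> D" and k: "k \<in> K z"
      have "P \<le> k * P" using k P by (simp add: K_iff)
      then have "1 \<le> k * P - z" using less[OF z] by linarith
      then show "k * P - z \<in> discarded_upto S x"
        using z k dvd by (auto simp: discarded_upto_def K_iff D_def discarded_centers_def
            dvd_neighbour_reflect)
    qed
    show "(\<lambda>a. ((- a) mod P, - ((- a) div P))) ` discarded_upto S x \<subseteq> (SIGMA z:D. K z)"
    proof (rule image_subsetI)
      fix a assume a: "a \<in> discarded_upto S x"
      define z where "z = (- a) mod P"
      define k where "k = - ((- a) div P)"
      have z_eq: "z = k * P - a"
        by (simp add: z_def k_def minus_mult_div_eq_mod[symmetric] algebra_simps)
      have z_bounds: "0 \<le> z" "z < P" using P by (simp_all add: z_def)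
      have "z \<in> D"
        using a z_bounds dvd
        by (auto simp: D_def discarded_centers_def P_def[symmetric] discarded_upto_def
            z_eq dvd_neighbour_reflect simp del: of_nat_prod)
      moreover have "0 < k * P" using z_bounds z_eq a by (auto simp: discarded_upto_def)
      then have "1 \<le> k" using P by (simp add: zero_less_mult_iff)
      then have "k \<in> K z" using a by (simp add: K_iff z_eq discarded_upto_def)
      ultimately show "((- a) mod P, - ((- a) div P)) \<in> (SIGMA z:D. K z)"
        by (simp add: z_def k_def)
    qed
  qed
  then have "card (discarded_upto S x) = card (SIGMA z:D. K z)"
    by (simp add: bij_betw_same_card)
  also have "\<dots> = (\<Sum>z\<in>D. card (K z))"
    using finD by (simp add: K_def)
  finally have "int (card (discarded_upto S x)) = (\<Sum>z\<in>D. int (card (K z)))"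
    by simp
  also have "\<dots> = (\<Sum>z\<in>D. \<lfloor>(x + real_of_int z) / real (\<Prod>S)\<rfloor>)"
  proof (rule sum.cong[OF refl])
    fix z assume "z \<in> D"
    then have "0 \<le> (x + real_of_int z) / real (\<Prod>S)"
      using \<open>x > 0\<close> by (auto simp: D_def discarded_centers_def intro!: divide_nonneg_nonneg prod_nonneg)
    then have "0 \<le> \<lfloor>(x + real_of_int z) / real (\<Prod>S)\<rfloor>"
      by (simp only: zero_le_floor)
    then show "int (card (K z)) = \<lfloor>(x + real_of_int z) / real (\<Prod>S)\<rfloor>"
      unfolding K_def card_atLeastAtMost_int by linarith
  qed
  finally show ?thesis by (simp only: discarded_count_def D_def)
qed

section \<open>The sieve formula\<close>

lemma prime_first_primes:
  assumes "p \<in> first_primes n"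
  shows "prime p"
  using assms enumerate_in_set[OF primes_infinite] by (auto simp: first_primes_def nth_prime_def)

theorem mainTheorem1:
  fixes n :: nat and x :: real
  assumes "n \<ge> 1" and "x > 0"
  shows "int (card (surviving_centers n x)) =
    \<lfloor>x\<rfloor> + (\<Sum>k = 1..n. (- 1) ^ k *
      (\<Sum>S | S \<subseteq> first_primes n \<and> card S = k. discarded_count S x))"
proof -
  let ?F = "first_primes n"
  let ?t = "\<lambda>S. (- 1) ^ card S * int (card (discarded_upto S x))"
  have fin: "finite ?F" by (simp add: first_primes_def)
  have card_le: "card S \<le> n" if "S \<subseteq> ?F" for S
    using card_mono[OF fin that] card_image_le[of "{1..n}" nth_prime]
    by (simp add: first_primes_def)
  have "surviving_centers n x =
      {a\<in>{1..\<lfloor>x\<rfloor>}. \<forall>p\<in>?F. \<not> (int p dvd a - 1 \<or> int p dvd a + 1)}"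
    by (auto simp: surviving_centers_def le_floor_iff)
  then have "int (card (surviving_centers n x)) = (\<Sum>S\<in>Pow ?F. ?t S)"
    unfolding discarded_upto_def by (simp only: card_sieve fin finite_atLeastAtMost_int)
  also have "\<dots> = (\<Sum>k = 0..n. \<Sum>S | S \<in> Pow ?F \<and> card S = k. ?t S)"
    using fin card_le by (intro sum.group[symmetric]) auto
  also have "\<dots> = (\<Sum>S | S \<in> Pow ?F \<and> card S = 0. ?t S)
      + (\<Sum>k = 1..n. \<Sum>S | S \<in> Pow ?F \<and> card S = k. ?t S)"
    by (simp add: sum.atLeast_Suc_atMost)
  also have "{S \<in> Pow ?F. card S = 0} = {{}}"
    using finite_subset[OF _ fin] by auto
  also have "(\<Sum>S\<in>{{}}. ?t S) = \<lfloor>x\<rfloor>"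
  proof -
    have "discarded_upto {} x = {1..\<lfloor>x\<rfloor>}" by (auto simp: discarded_upto_def)
    then show ?thesis using \<open>x > 0\<close> by simp
  qed
  also have "(\<Sum>k = 1..n. \<Sum>S | S \<in> Pow ?F \<and> card S = k. ?t S) =
      (\<Sum>k = 1..n. (- 1) ^ k * (\<Sum>S | S \<subseteq> ?F \<and> card S = k. discarded_count S x))"
    unfolding sum_distrib_left
  proof (intro sum.cong)
    fix k S assume k: "k \<in> {1..n}" and "S \<in> {S. S \<subseteq> ?F \<and> card S = k}"
    then have S: "S \<subseteq> ?F" "card S = k" by auto
    have "discarded_count S x = int (card (discarded_upto S x))"
    proof (rule discarded_count_eq_card)
      show "finite S" using S(1) fin by (rule finite_subset)
      show "S \<noteq> {}" using S(2) k by auto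
      show "p > 1" if "p \<in> S" for p
        using that S(1) prime_first_primes prime_gt_1_nat by blast
    qed (fact \<open>x > 0\<close>)
    then show "?t S = (- 1) ^ k * discarded_count S x" using S(2) by simp
  qed auto
  finally show ?thesis .
qed

end
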